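(* Binary prefix normality is expressible by weighted prefix normality: there exists a weight measure $\mu$ over $\Sigma=\{0,1\}$ (with respect to some strictly totally ordered monoid) such that for every $w\in\{0,1\}^*$, $w$ is $\mu$-prefix normal if and only if $w$ is prefix normal.
   Context: $\Sigma^*$ is the free monoid of finite words over the finite alphabet $\Sigma$, $\varepsilon$ the empty word, $\Sigma^+=\Sigma^*\setminus\{\varepsilon\}$, $|w|$ the length of $w$, $|w|_1$ the number of occurrences of the letter $1$ in $w$. $[n]_0=\{0,\dots,n\}$. $\mathrm{Fact}_i(w)$ is the set of factors (contiguous subwords) of $w$ of length $i$. Binary prefix normality: for $w\in\{0,1\}^*$ let $f_w,p_w:[|w|]_0\to\mathbb{N}_0$, $f_w(i)=\max\{|u|_1\mid u\in\mathrm{Fact}_i(w)\}$ and $p_w(i)=|u|_1$ where $u$ is the prefix of $w$ of length $i$; $w$ is prefix normal if $f_w=p_w$. A strictly totally ordered monoid is a monoid $(A,\circ_A)$ with a total order $<_A$ such that $a<_A b$ implies $a\circ_A c<_A b\circ_A c$ and $c\circ_A a<_A c\circ_A b$ for all $a,b,c\in A$. A weight measure over $\Sigma$ w.r.t. $A$ is a monoid morphism $\mu:\Sigma^*\to A$ such that $\mu(vw)=\mu(wv)$ and $\mu(w)<_A\mu(wv)$ for all $w\in\Sigma^*$, $v\in\Sigma^+$. Weighted prefix normality: for $w\in\Sigma^*$ define $f_{w,\mu},p_{w,\mu}:[|w|]_0\to A$ by $f_{w,\mu}(i)=\max\{\mu(u)\mid u\in\mathrm{Fact}_i(w)\}$ and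 $p_{w,\mu}(i)=\mu(\text{prefix of } w\text{ of length } i)$; $w$ is $\mu$-prefix normal if $p_{w,\mu}=f_{w,\mu}$. *)

theory Defs
  imports "HOL-Algebra.Group" "HOL-Library.Sublist"
begin

definition factors :: "nat \<Rightarrow> 'a list \<Rightarrow> 'a list set" where
  "factors i w = {u. sublist u w \<and> length u = i}"


text \<open>Binary words are the elements of \<open>lists {0, 1 :: nat}\<close>.\<close>

definition max_ones :: "nat list \<Rightarrow> nat \<Rightarrow> nat" where
  "max_ones w i = Max ((\<lambda>u. count_list u 1) ` factors i w)"

definition prefix_ones :: "nat list \<Rightarrow> nat \<Rightarrow> nat" where
  "prefix_ones w i = count_list (take i w) 1"

definition prefix_normal :: "nat list \<Rightarrow> bool" where
  "prefix_normal w \<longleftrightarrow> (\<forall>i \<in> {0..length w}. max_ones w i = prefix_ones w i)"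


definition free_monoid :: "'a set \<Rightarrow> 'a list monoid" where
  "free_monoid \<Sigma> = \<lparr>carrier = lists \<Sigma>, mult = (@), one = []\<rparr>"

locale strictly_totally_ordered_monoid = monoid A
  for A :: "('b, 'c) monoid_scheme" (structure) +
  fixes lt :: "'b \<Rightarrow> 'b \<Rightarrow> bool"
  assumes irreflp_lt: "irreflp_on (carrier A) lt"
    and transp_lt: "transp_on (carrier A) lt"
    and totalp_lt: "totalp_on (carrier A) lt"
    and mult_lt_right: "\<lbrakk>a \<in> carrier A; b \<in> carrier A; c \<in> carrier A; lt a b\<rbrakk>
      \<Longrightarrow> lt (a \<otimes> c) (b \<otimes> c)"
    and mult_lt_left: "\<lbrakk>a \<in> carrier A; b \<in> carrier A; c \<in> carrier A; lt a b\<rbrakk>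
      \<Longrightarrow> lt (c \<otimes> a) (c \<otimes> b)"

text \<open>The set \<^term>\<open>hom G H\<close> does not require the unit to be preserved,
  so this is a separate assumption.\<close>

locale weight_measure = strictly_totally_ordered_monoid A lt
  for A :: "('b, 'c) monoid_scheme" (structure) and lt :: "'b \<Rightarrow> 'b \<Rightarrow> bool" +
  fixes \<Sigma> :: "'a set" and \<mu> :: "'a list \<Rightarrow> 'b"
  assumes finite_alphabet: "finite \<Sigma>"
    and hom: "\<mu> \<in> hom (free_monoid \<Sigma>) A"
    and hom_one: "\<mu> \<one>\<^bsub>free_monoid \<Sigma>\<^esub> = \<one>"
    and weight_commute: "\<lbrakk>v \<in> lists \<Sigma>; w \<in> lists \<Sigma>\<rbrakk> \<Longrightarrow> \<mu> (v @ w) = \<mu> (w @ v)"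
    and weight_increasing: "\<lbrakk>w \<in> lists \<Sigma>; v \<in> lists \<Sigma>; v \<noteq> []\<rbrakk> \<Longrightarrow> lt (\<mu> w) (\<mu> (w @ v))"

text \<open>The maximum of a set with respect to a strict order given as a predicate; it is well-defined
  on finite nonempty sets on which the order is total.\<close>

definition maximum_wrt :: "('b \<Rightarrow> 'b \<Rightarrow> bool) \<Rightarrow> 'b set \<Rightarrow> 'b" where
  "maximum_wrt lt S = (THE m. m \<in> S \<and> (\<forall>x \<in> S. x = m \<or> lt x m))"

definition max_weight :: "('b \<Rightarrow> 'b \<Rightarrow> bool) \<Rightarrow> ('a list \<Rightarrow> 'b) \<Rightarrow> 'a list \<Rightarrow> nat \<Rightarrow> 'b" where
  "max_weight lt \<mu> w i = maximum_wrt lt (\<mu> ` factors i w)"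

definition prefix_weight :: "('a list \<Rightarrow> 'b) \<Rightarrow> 'a list \<Rightarrow> nat \<Rightarrow> 'b" where
  "prefix_weight \<mu> w i = \<mu> (take i w)"

definition weighted_prefix_normal ::
    "('b \<Rightarrow> 'b \<Rightarrow> bool) \<Rightarrow> ('a list \<Rightarrow> 'b) \<Rightarrow> 'a list \<Rightarrow> bool" where
  "weighted_prefix_normal lt \<mu> w \<longleftrightarrow>
     (\<forall>i \<in> {0..length w}. prefix_weight \<mu> w i = max_weight lt \<mu> w i)"

end

theory Submission
  imports Defs
begin

text \<open>Give \<open>0\<close> weight 1 and \<open>1\<close> weight 2 in \<open>(\<nat>, +)\<close>. On factors of a fixed length \<open>i\<close>
  the weight and the number of ones then differ by the constant \<open>i\<close>, so both have the same
  maximisers.\<close>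

lemma finite_factors: "finite (factors i w)"
  unfolding factors_def by (rule finite_subset[of _ "set (sublists w)"]) auto

lemma take_in_factors: "i \<le> length w \<Longrightarrow> take i w \<in> factors i w"
  by (simp add: factors_def)

text \<open>Bridge from the \<open>THE\<close>-based maximum to \<open>Max\<close>: for
  \<open><\<close> the defining property of \<open>m\<close> is that of a greatest element, which is
  unique.\<close>

lemma maximum_wrt_less_eq_Max:
  fixes S :: "'a::linorder set"
  assumes "finite S" "S \<noteq> {}"
  shows "maximum_wrt (<) S = Max S"
proof -
  have "(\<forall>x\<in>S. x = m \<or> x < m) \<longleftrightarrow> (\<forall>x\<in>S. x \<le> m)" for m
    by (auto simp: order.order_iff_strict)
  then show ?thesis
    unfolding maximum_wrt_def using assms
    by (intro the_equality) (auto intro: Max_eqI[symmetric])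
qed

definition length_plus_ones :: "nat list \<Rightarrow> nat" where
  "length_plus_ones w = length w + count_list w 1"

lemma max_weight_length_plus_ones:
  assumes "i \<le> length w"
  shows "max_weight (<) length_plus_ones w i = i + max_ones w i"
proof -
  let ?F = "factors i w"
  have F: "finite ?F" "?F \<noteq> {}"
    using finite_factors take_in_factors[OF assms] by auto
  have "length_plus_ones ` ?F = (+) i ` (\<lambda>u. count_list u 1) ` ?F"
    unfolding image_image by (rule image_cong) (auto simp: length_plus_ones_def factors_def)
  \<comment> \<open>Translation by \<open>i\<close> is monotone, so it commutes with
    \<open>Max\<close>.\<close>
  moreover have "Max ((+) i ` (\<lambda>u. count_list u 1) ` ?F) = i + max_ones w i"
    unfolding max_ones_def using F
    by (intro mono_Max_commute[symmetric]) (auto intro: monoI)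
  ultimately show ?thesis
    using F by (simp add: max_weight_def maximum_wrt_less_eq_Max)
qed

text \<open>For each \<open>i\<close> the prefix \<open>take i w\<close> also has length
  \<open>i\<close>, so the same summand \<open>i\<close> cancels on both sides.\<close>

lemma weighted_prefix_normal_length_plus_ones:
  "weighted_prefix_normal (<) length_plus_ones w \<longleftrightarrow> prefix_normal w"
  unfolding weighted_prefix_normal_def prefix_normal_def
  by (intro ball_cong refl)
    (auto simp: max_weight_length_plus_ones prefix_weight_def length_plus_ones_def prefix_ones_def)

text \<open>The length summand makes appending \<open>0\<close> increase the weight strictly; the
  number of ones alone would not grow. Commutation is inherited from \<open>+\<close>.\<close>

lemma weight_measure_length_plus_ones:
  "weight_measure \<lparr>carrier = UNIV, mult = (+), one = 0\<rparr> (<) {0, 1} length_plus_ones"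
  by unfold_locales
    (auto simp: irreflp_on_def transp_on_def totalp_on_def hom_def free_monoid_def
      length_plus_ones_def)

theorem proposition9:
  "\<exists>(A :: nat monoid) (lt :: nat \<Rightarrow> nat \<Rightarrow> bool) (\<mu> :: nat list \<Rightarrow> nat).
     weight_measure A lt {0, 1} \<mu> \<and>
     (\<forall>w \<in> lists {0, 1}. weighted_prefix_normal lt \<mu> w \<longleftrightarrow> prefix_normal w)"
  using weight_measure_length_plus_ones weighted_prefix_normal_length_plus_ones by blast

end
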